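(* Let $G$ be a connected, undirected, weighted graph on $\mathcal{V}=\{1,\dots,N\}$ with Laplacian $\mathbf{L}$, let $\delta>0$, let $\mathbf{K}=(\mathbf{L}+\delta\mathbf{I})^{-1}$, and let $1\le m\le N-1$. Then $$\operatorname*{arg\,max}_{\mathcal{S}\subseteq\mathcal{V},\,|\mathcal{S}|=m}\ \Omega_1(\mathcal{S}) \;=\; \operatorname*{arg\,min}_{\mathcal{S}\subseteq\mathcal{V},\,|\mathcal{S}|=m}\ \lambda_{\max}\big[\mathbf{K}_{\mathcal{S}^c|\mathcal{S}}\big],$$ i.e. a set $\mathcal{S}_{\text{opt}}$ of size $m$ maximizes $\Omega_1(\mathcal{S})$ among all subsets of size $m$ if and only if it minimizes the largest eigenvalue of the predictive covariance $\mathbf{K}_{\mathcal{S}^c|\mathcal{S}}$ among all subsets of size $m$.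
   Context: Graph: $G=(\mathcal{V},\mathcal{E})$ is connected, undirected, with positive edge weights $w_{ij}=w_{ji}$; $\mathbf{W}=(w_{ij})$ is the adjacency matrix (zero entry where there is no edge), $\mathbf{D}=\mathrm{diag}\{d_1,\dots,d_N\}$ with $d_i=\sum_j w_{ij}$, and $\mathbf{L}=\mathbf{D}-\mathbf{W}$ (positive semi-definite). $\mathbf{I}$ is the $N\times N$ identity matrix. Notation: for $\mathcal{S}\subseteq\mathcal{V}$, $\mathcal{S}^c=\mathcal{V}\setminus\mathcal{S}$; $\mathbf{A}_{\mathcal{S}_1\mathcal{S}_2}$ is the submatrix of $\mathbf{A}$ with rows $\mathcal{S}_1$ and columns $\mathcal{S}_2$, and $\mathbf{A}_{\mathcal{S}}=\mathbf{A}_{\mathcal{S}\mathcal{S}}$; $\mathbf{A}^+$ is the Moore–Penrose pseudo-inverse (equal to the inverse when $\mathbf{A}$ is invertible); $\lambda_{\min}[\cdot]$ and $\lambda_{\max}[\cdot]$ are the smallest and largest eigenvalues of a symmetric matrix. Cut-off frequency estimate: for an integer $k\ge1$, $\Omega_k(\mathcal{S})=\big(\lambda_{\min}[(\mathbf{L}^k)_{\mathcal{S}^c}]\big)^{1/k}$; in particular $\Omega_1(\mathcal{S})=\lambda_{\min}[\mathbf{L}_{\mathcal{S}^c}]$. Predictive covariance: for a zero-mean Gaussian random field $\mathbf{f}$ with covariance $\mathbf{K}$, the predictive (conditional) covariance matrix of $\mathbf{f}_{\mathcal{S}^c}$ given $\mathbf{f}_{\mathcal{S}}$ is $\mathbf{K}_{\mathcal{S}^c|\mathcal{S}}=\mathbf{K}_{\mathcal{S}^c}-\mathbf{K}_{\mathcal{S}^c\mathcal{S}}(\mathbf{K}_{\mathcal{S}})^{+}\mathbf{K}_{\mathcal{S}\mathcal{S}^c}$.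 *)

theory Defs
  imports
    "Graph_Theory.Digraph_Component"
    "Jordan_Normal_Form.DL_Submatrix"
    "Jordan_Normal_Form.Gauss_Jordan_Elimination"
    "Jordan_Normal_Form.Spectral_Radius"
begin

text \<open>
  The vertex set is \<open>{0..<N}\<close>, matching the zero-based matrix indices of
  Jordan normal form matrices. An undirected graph is a symmetric pair digraph; loops are
  not excluded (they do not contribute to the Laplacian).
  The values of \<open>w\<close> off the edge set are irrelevant.
\<close>

definition weighted_graph :: "nat \<Rightarrow> nat pair_pre_digraph \<Rightarrow> (nat \<Rightarrow> nat \<Rightarrow> real) \<Rightarrow> bool" where
  "weighted_graph N G w \<longleftrightarrow>
     pair_sym_digraph G \<and> pverts G = {0..<N} \<and>
     (\<forall>(i, j) \<in> parcs G. w i j > 0 \<and> w i j = w j i)"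

definition adjacency_mat :: "nat \<Rightarrow> nat pair_pre_digraph \<Rightarrow> (nat \<Rightarrow> nat \<Rightarrow> real) \<Rightarrow> real mat" where
  "adjacency_mat N G w = mat N N (\<lambda>(i, j). if (i, j) \<in> parcs G then w i j else 0)"

definition degree_mat :: "nat \<Rightarrow> nat pair_pre_digraph \<Rightarrow> (nat \<Rightarrow> nat \<Rightarrow> real) \<Rightarrow> real mat" where
  "degree_mat N G w = mat_diag N (\<lambda>i. \<Sum>j<N. adjacency_mat N G w $$ (i, j))"

definition laplacian :: "nat \<Rightarrow> nat pair_pre_digraph \<Rightarrow> (nat \<Rightarrow> nat \<Rightarrow> real) \<Rightarrow> real mat" where
  "laplacian N G w = degree_mat N G w - adjacency_mat N G w"

text \<open>
  Extremal eigenvalues; meaningful for symmetric matrices of positive dimension, whose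
  spectrum over the reals is finite and nonempty.
\<close>

definition lambda_min :: "real mat \<Rightarrow> real" where
  "lambda_min A = Min (spectrum A)"

definition lambda_max :: "real mat \<Rightarrow> real" where
  "lambda_max A = Max (spectrum A)"

definition is_pinv :: "real mat \<Rightarrow> real mat \<Rightarrow> bool" where
  "is_pinv A X \<longleftrightarrow>
     X \<in> carrier_mat (dim_col A) (dim_row A) \<and>
     A * X * A = A \<and> X * A * X = X \<and>
     transpose_mat (A * X) = A * X \<and> transpose_mat (X * A) = X * A"

text \<open>The Moore--Penrose pseudo-inverse, as the unique solution of the Penrose equations.\<close>

definition pinv :: "real mat \<Rightarrow> real mat" where
  "pinv A = (THE X. is_pinv A X)"

definition cutoff_freq :: "nat \<Rightarrow> real mat \<Rightarrow> nat set \<Rightarrow> real" where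
  "cutoff_freq k L S =
     (let Sc = {0..<dim_row L} - S
      in root k (lambda_min (submatrix (L ^\<^sub>m k) Sc Sc)))"

definition predictive_cov :: "real mat \<Rightarrow> nat set \<Rightarrow> real mat" where
  "predictive_cov K S =
     (let Sc = {0..<dim_row K} - S
      in submatrix K Sc Sc - submatrix K Sc S * pinv (submatrix K S S) * submatrix K S Sc)"

text \<open>
  The covariance \<open>(L + \<delta> I)\<^sup>-\<^sup>1\<close>. The library function \<open>mat_inverse\<close> is option-valued; the
  matrix is invertible for a graph Laplacian \<open>L\<close> and \<open>\<delta> > 0\<close>, so \<open>the\<close> is applied to a proper value.
\<close>

definition grf_cov :: "real mat \<Rightarrow> real \<Rightarrow> real mat" where
  "grf_cov L \<delta> = the (mat_inverse (L + \<delta> \<cdot>\<^sub>m 1\<^sub>m (dim_row L)))"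

end

theory Submission
  imports Defs
begin

text \<open>
  Put \<open>M = L + \<delta> I\<close> and \<open>K = M\<^sup>-\<^sup>1\<close>. By the Schur complement formula the predictive covariance of
  the complement \<open>T\<close> of \<open>S\<close> is the inverse of the block \<open>M\<^sub>T = L\<^sub>T + \<delta> I\<close>, so its eigenvalues are
  \<open>1 / (x + \<delta>)\<close> with \<open>x\<close> an eigenvalue of \<open>L\<^sub>T\<close>. These \<open>x\<close> are real because \<open>L\<^sub>T\<close> is symmetric, and
  nonnegative because \<open>L\<^sub>T\<close> is diagonally dominant. Hence the largest eigenvalue of the predictive
  covariance is \<open>1 / (\<Omega>\<^sub>1(S) + \<delta>)\<close>, a strictly decreasing function of \<open>\<Omega>\<^sub>1(S)\<close>.
\<close>

subsection \<open>Eigenvalues of symmetric and of diagonally dominant matrices\<close>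

text \<open>Coordinate form of the eigenvector equation, shared by the two arguments below that
  manipulate it as a sum over a row.\<close>

lemma eigenvalue_sumE:
  fixes A :: "'a :: field mat"
  assumes A: "A \<in> carrier_mat n n" and "eigenvalue A k"
  obtains v i where "v \<in> carrier_vec n" "i < n" "v $ i \<noteq> 0"
    "\<And>i. i < n \<Longrightarrow> (\<Sum>j<n. A $$ (i, j) * v $ j) = k * v $ i"
proof -
  obtain v where v: "v \<in> carrier_vec n" "v \<noteq> 0\<^sub>v n" "A *\<^sub>v v = k \<cdot>\<^sub>v v"
    using assms by (auto simp: eigenvalue_def eigenvector_def)
  have "(\<Sum>j<n. A $$ (i, j) * v $ j) = k * v $ i" if "i < n" for i
  proof -
    have "(A *\<^sub>v v) $ i = (k \<cdot>\<^sub>v v) $ i"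
      using v by simp
    then show ?thesis
      using that A v(1) by (simp add: scalar_prod_def atLeast0LessThan)
  qed
  moreover have "\<exists>i<n. v $ i \<noteq> 0"
    using v(1,2) by (metis carrier_vecD eq_vecI index_zero_vec)
  ultimately show thesis
    using that v(1) by blast
qed

text \<open>Over the complex numbers an eigenvalue always exists, and symmetry forces it to be real.
  Without this, \<open>Min\<close> and \<open>Max\<close> of the real spectrum could be taken over
  the empty set.\<close>

lemma symmetric_spectrum_nonempty:
  fixes A :: "real mat"
  assumes A: "A \<in> carrier_mat n n" and "n > 0"
    and sym: "\<And>i j. i < n \<Longrightarrow> j < n \<Longrightarrow> A $$ (i, j) = A $$ (j, i)"
  shows "spectrum A \<noteq> {}"
proof -
  let ?C = "map_mat complex_of_real A"
  have C: "?C \<in> carrier_mat n n"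
    using A by simp
  obtain k where "k \<in> spectrum ?C"
    using spectrum_non_empty[OF C \<open>n > 0\<close>] by blast
  then have ev: "eigenvalue ?C k"
    by (simp add: spectrum_def)
  obtain v i where v: "i < n" "v $ i \<noteq> 0"
    and Av: "\<And>i. i < n \<Longrightarrow> (\<Sum>j<n. ?C $$ (i, j) * v $ j) = k * v $ i"
    using eigenvalue_sumE[OF C ev] by metis
  \<comment> \<open>\<open>q\<close> is the Hermitian form of \<open>A\<close> at the complex
    eigenvector \<open>v\<close>, and \<open>r\<close> is the squared norm of \<open>v\<close>; the
    aim is q = k r with both q and r real.\<close>
  define q where "q = (\<Sum>i<n. \<Sum>j<n. complex_of_real (A $$ (i, j)) * v $ j * cnj (v $ i))"
  define r where "r = (\<Sum>i<n. (cmod (v $ i))\<^sup>2)"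
  have "q = (\<Sum>i<n. (\<Sum>j<n. ?C $$ (i, j) * v $ j) * cnj (v $ i))"
    unfolding q_def using A by (simp add: sum_distrib_right)
  also have "\<dots> = (\<Sum>i<n. k * of_real ((cmod (v $ i))\<^sup>2))"
    by (intro sum.cong refl) (simp only: lessThan_iff Av mult.assoc complex_norm_square)
  also have "\<dots> = k * of_real r"
    by (simp add: r_def sum_distrib_left)
  finally have q: "q = k * of_real r" .
  have "r > 0"
    unfolding r_def using v by (intro sum_pos2[of _ i]) auto
  have "cnj q = (\<Sum>i<n. \<Sum>j<n. complex_of_real (A $$ (i, j)) * cnj (v $ j) * v $ i)"
    by (simp add: q_def)
  also have "\<dots> = (\<Sum>j<n. \<Sum>i<n. complex_of_real (A $$ (i, j)) * cnj (v $ j) * v $ i)"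
    by (rule sum.swap)
  \<comment> \<open>After the swap, conjugation has merely exchanged the two indices, which symmetry
    of \<open>A\<close> undoes.\<close>
  also have "\<dots> = q"
    unfolding q_def using sym by (intro sum.cong refl) (simp add: mult_ac)
  finally have "cnj k = k"
    using q \<open>r > 0\<close> by simp
  then have k: "k = of_real (Re k)"
    by (metis Reals_cnj_iff of_real_Re)
  \<comment> \<open>The complex characteristic polynomial is the image of the real one, so a real
    root of it is an eigenvalue of \<open>A\<close> itself.\<close>
  have "poly (map_poly complex_of_real (char_poly A)) (of_real (Re k)) = 0"
    using ev k unfolding eigenvalue_root_char_poly[OF C] of_real_hom.char_poly_hom[OF A] by simp
  then have "poly (char_poly A) (Re k) = 0"
    by (simp only: of_real_hom.poly_map_poly of_real_eq_0_iff)
  then show ?thesis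
    using spectrum_root_char_poly[OF A] by auto
qed

text \<open>The diagonal entry carries no absolute value, so it is forced to be nonnegative. Unlike
  vanishing row sums, the condition passes to principal submatrices.\<close>

definition diag_dominant :: "real mat \<Rightarrow> bool" where
  "diag_dominant A \<longleftrightarrow>
     (\<forall>i<dim_row A. (\<Sum>j\<in>{..<dim_row A} - {i}. \<bar>A $$ (i, j)\<bar>) \<le> A $$ (i, i))"

text \<open>Gershgorin's argument at an entry of the eigenvector of maximal modulus.\<close>

lemma diag_dominant_eigenvalue_nonneg:
  assumes A: "A \<in> carrier_mat n n" and "diag_dominant A" and ev: "eigenvalue A k"
  shows "k \<ge> 0"
proof -
  obtain v p where p: "p < n" "v $ p \<noteq> 0"
    and Av: "\<And>i. i < n \<Longrightarrow> (\<Sum>j<n. A $$ (i, j) * v $ j) = k * v $ i"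
    using eigenvalue_sumE[OF A ev] by metis
  obtain i where i: "i < n" and max: "\<And>j. j < n \<Longrightarrow> \<bar>v $ j\<bar> \<le> \<bar>v $ i\<bar>"
  proof -
    have "Max ((\<lambda>j. \<bar>v $ j\<bar>) ` {..<n}) \<in> (\<lambda>j. \<bar>v $ j\<bar>) ` {..<n}"
      using p by (intro Max_in) auto
    then obtain i where "i < n" "Max ((\<lambda>j. \<bar>v $ j\<bar>) ` {..<n}) = \<bar>v $ i\<bar>"
      by auto
    then show thesis
      using that by (metis Max_ge finite_imageI finite_lessThan imageI lessThan_iff)
  qed
  have "v $ i \<noteq> 0"
    using max[OF p(1)] p(2) by auto
  have "k * v $ i = A $$ (i, i) * v $ i + (\<Sum>j\<in>{..<n} - {i}. A $$ (i, j) * v $ j)"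
    using Av[OF i] i by (simp add: sum.remove[of "{..<n}" i])
  then have "\<bar>k - A $$ (i, i)\<bar> * \<bar>v $ i\<bar> = \<bar>\<Sum>j\<in>{..<n} - {i}. A $$ (i, j) * v $ j\<bar>"
    by (simp add: abs_mult[symmetric] left_diff_distrib)
  also have "\<dots> \<le> (\<Sum>j\<in>{..<n} - {i}. \<bar>A $$ (i, j)\<bar> * \<bar>v $ i\<bar>)"
    by (rule order_trans[OF sum_abs]) (auto simp: abs_mult intro!: sum_mono mult_left_mono max)
  also have "\<dots> \<le> A $$ (i, i) * \<bar>v $ i\<bar>"
    using \<open>diag_dominant A\<close> A i
    by (auto simp: diag_dominant_def sum_distrib_right[symmetric] intro!: mult_right_mono)
  \<comment> \<open>Cancelling the modulus of the maximal entry leaves |k - a| \<le> a for the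
    diagonal entry a, hence k \<ge> 0.\<close>
  finally show ?thesis
    using \<open>v $ i \<noteq> 0\<close> by simp
qed

section \<open>Inverses and spectra of shifted matrices\<close>

lemma square_inverse_exists:
  fixes A :: "'a :: field mat"
  assumes A: "A \<in> carrier_mat n n" and "det A \<noteq> 0"
  obtains B where "B \<in> carrier_mat n n" "A * B = 1\<^sub>m n" "B * A = 1\<^sub>m n"
    "mat_inverse A = Some B"
proof (cases "mat_inverse A")
  case None
  then show thesis
    using mat_inverse(1)[OF A None, of "()"] det_non_zero_imp_unit[OF assms, of "()"] by blast
next
  case (Some B)
  then show thesis
    using mat_inverse(2)[OF A Some] that by blast
qed

text \<open>A singular shift would make -\<delta> an eigenvalue of \<open>A\<close>, which dominance
  excludes.\<close>

lemma diag_dominant_shift_det: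
  assumes A: "A \<in> carrier_mat n n" and "diag_dominant A" and "\<delta> > 0"
  shows "det (A + \<delta> \<cdot>\<^sub>m 1\<^sub>m n) \<noteq> 0"
proof
  assume "det (A + \<delta> \<cdot>\<^sub>m 1\<^sub>m n) = 0"
  then have "eigenvalue A (- \<delta>)"
    using A by (simp add: eigenvalue_det[OF A] char_matrix_def)
  then show False
    using diag_dominant_eigenvalue_nonneg[OF A \<open>diag_dominant A\<close>] \<open>\<delta> > 0\<close> by fastforce
qed

text \<open>\<open>A\<close> and the inverse of its shift have the same eigenvectors, so eigenvalues
  correspond one by one.\<close>

lemma spectrum_inverse_shift:
  fixes A :: "'a :: field mat"
  assumes A: "A \<in> carrier_mat n n" and P: "P \<in> carrier_mat n n"
    and inv: "P * (A + d \<cdot>\<^sub>m 1\<^sub>m n) = 1\<^sub>m n"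
  shows "spectrum P = (\<lambda>x. 1 / (x + d)) ` spectrum A"
proof -
  define M where "M = A + d \<cdot>\<^sub>m 1\<^sub>m n"
  have M: "M \<in> carrier_mat n n"
    using A by (simp add: M_def)
  have PM: "P * M = 1\<^sub>m n" and MP: "M * P = 1\<^sub>m n"
    using inv mat_mult_left_right_inverse[OF P M] by (simp_all add: M_def)
  have Mv: "M *\<^sub>v v = A *\<^sub>v v + d \<cdot>\<^sub>v v" if "v \<in> carrier_vec n" for v
    using A that by (intro eq_vecI) (auto simp: M_def add_scalar_prod_distrib[of _ n])
  have *: "P *\<^sub>v (M *\<^sub>v v) = v" "M *\<^sub>v (P *\<^sub>v v) = v" if "v \<in> carrier_vec n" for v
    using P M that PM MP by (simp_all flip: assoc_mult_mat_vec)
  have zero: "0 \<cdot>\<^sub>v u = 0\<^sub>v n" if "u \<in> carrier_vec n" for u :: "'a vec"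
    using that by (intro eq_vecI) auto
  have "eigenvalue P (1 / (x + d))" if ev: "eigenvalue A x" for x
  proof -
    obtain v where v: "v \<in> carrier_vec n" "v \<noteq> 0\<^sub>v n" "A *\<^sub>v v = x \<cdot>\<^sub>v v"
      using ev A by (auto simp: eigenvalue_def eigenvector_def)
    have "M *\<^sub>v v = (x + d) \<cdot>\<^sub>v v"
      using Mv v by (simp add: add_smult_distrib_vec)
    then have eq: "v = (x + d) \<cdot>\<^sub>v (P *\<^sub>v v)"
      using *(1)[OF v(1)] P v(1) by (simp add: mult_mat_vec)
    \<comment> \<open>Otherwise \<open>v\<close> would vanish; thus the convention for division by
      zero never enters.\<close>
    then have nz: "x + d \<noteq> 0"
      using v(1,2) P zero[of "P *\<^sub>v v"] by auto
    have "P *\<^sub>v v = (1 / (x + d)) \<cdot>\<^sub>v ((x + d) \<cdot>\<^sub>v (P *\<^sub>v v))"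
      using nz by (simp add: smult_smult_assoc)
    then have "P *\<^sub>v v = (1 / (x + d)) \<cdot>\<^sub>v v"
      by (simp only: eq[symmetric])
    then show ?thesis
      using v P by (auto simp: eigenvalue_def eigenvector_def)
  qed
  moreover have "\<exists>x. eigenvalue A x \<and> y = 1 / (x + d)" if ev: "eigenvalue P y" for y
  proof -
    obtain v where v: "v \<in> carrier_vec n" "v \<noteq> 0\<^sub>v n" "P *\<^sub>v v = y \<cdot>\<^sub>v v"
      using ev P by (auto simp: eigenvalue_def eigenvector_def)
    have eq: "v = y \<cdot>\<^sub>v (A *\<^sub>v v + d \<cdot>\<^sub>v v)"
      using *(2)[OF v(1)] M v Mv by (simp add: mult_mat_vec)
    then have nz: "y \<noteq> 0"
      using v(1,2) A zero[of "A *\<^sub>v v + d \<cdot>\<^sub>v v"] by auto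
    \<comment> \<open>The value \<open>1 / y - d\<close> is the solution x of y = 1 / (x +
      d).\<close>
    have "A *\<^sub>v v = (1 / y - d) \<cdot>\<^sub>v v"
    proof (rule eq_vecI)
      fix i assume "i < dim_vec ((1 / y - d) \<cdot>\<^sub>v v)"
      then have i: "i < n"
        using v(1) by simp
      have "v $ i = y * ((A *\<^sub>v v) $ i + d * v $ i)"
        using arg_cong[OF eq, of "\<lambda>u. u $ i"] v(1) A i by simp
      then show "(A *\<^sub>v v) $ i = ((1 / y - d) \<cdot>\<^sub>v v) $ i"
        using nz v(1) i by (simp add: field_simps)
    qed (use A v in auto)
    then have "eigenvalue A (1 / y - d)"
      using v A by (auto simp: eigenvalue_def eigenvector_def)
    then show ?thesis
      by (intro exI[of _ "1 / y - d"]) simp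
  qed
  ultimately show ?thesis
    by (auto simp: spectrum_def)
qed

text \<open>On nonnegative x the map 1 / (x + d) is decreasing with positive denominator, so its
  maximum is attained at the least eigenvalue.\<close>

lemma lambda_max_inverse_shift:
  assumes A: "A \<in> carrier_mat n n" and P: "P \<in> carrier_mat n n"
    and inv: "P * (A + d \<cdot>\<^sub>m 1\<^sub>m n) = 1\<^sub>m n"
    and "d > 0" and "spectrum A \<noteq> {}" and nonneg: "\<And>x. x \<in> spectrum A \<Longrightarrow> x \<ge> 0"
  shows "lambda_max P = 1 / (lambda_min A + d)"
  unfolding lambda_max_def
proof (rule Max_eqI)
  have fin: "finite (spectrum A)"
    using card_finite_spectrum(1)[OF A] .
  show "finite (spectrum P)"
    using card_finite_spectrum(1)[OF P] .
  have mem: "lambda_min A \<in> spectrum A"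
    unfolding lambda_min_def using fin \<open>spectrum A \<noteq> {}\<close> by (rule Min_in)
  then show "1 / (lambda_min A + d) \<in> spectrum P"
    unfolding spectrum_inverse_shift[OF A P inv] by (rule imageI)
  fix y assume "y \<in> spectrum P"
  then obtain x where x: "x \<in> spectrum A" "y = 1 / (x + d)"
    unfolding spectrum_inverse_shift[OF A P inv] by blast
  then have "lambda_min A \<le> x"
    unfolding lambda_min_def using fin by simp
  then show "y \<le> 1 / (lambda_min A + d)"
    using x(2) nonneg[OF mem] \<open>d > 0\<close> by (simp add: frac_le)
qed

subsection \<open>Submatrices and Schur complements\<close>

text \<open>This lets sums over the indices of a submatrix be rewritten as sums over the index set
  in the full matrix.\<close>

lemma bij_betw_pick:
  assumes "finite I"
  shows "bij_betw (pick I) {..<card I} I"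
proof (rule bij_betwI')
  fix x y assume "x \<in> {..<card I}" "y \<in> {..<card I}"
  then show "(pick I x = pick I y) = (x = y)"
    by (metis card_pick_le lessThan_iff)
next
  fix x assume "x \<in> {..<card I}"
  then show "pick I x \<in> I"
    by (simp add: pick_in_set_le)
next
  fix y assume "y \<in> I"
  moreover from this have "card {a \<in> I. a < y} < card I"
    using assms by (intro psubset_card_mono) auto
  \<comment> \<open>The preimage of \<open>y\<close> is its rank, the number of elements of
    \<open>I\<close> below it.\<close>
  ultimately show "\<exists>x\<in>{..<card I}. y = pick I x"
    using pick_card_in_set[of y I] by (intro bexI[of _ "card {a \<in> I. a < y}"]) simp_all
qed

lemma pick_less_dim: "I \<subseteq> {0..<n} \<Longrightarrow> i < card I \<Longrightarrow> pick I i < n"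
  using pick_in_set_le[of i I] by auto

lemma submatrix_carrier:
  assumes "A \<in> carrier_mat nr nc" "I \<subseteq> {0..<nr}" "J \<subseteq> {0..<nc}"
  shows "submatrix A I J \<in> carrier_mat (card I) (card J)"
    and "i < card I \<Longrightarrow> j < card J \<Longrightarrow> submatrix A I J $$ (i, j) = A $$ (pick I i, pick J j)"
proof -
  have "{i. i < nr \<and> i \<in> I} = I" "{j. j < nc \<and> j \<in> J} = J"
    using assms by auto
  then show "submatrix A I J \<in> carrier_mat (card I) (card J)"
    "i < card I \<Longrightarrow> j < card J \<Longrightarrow> submatrix A I J $$ (i, j) = A $$ (pick I i, pick J j)"
    using assms(1) by (auto simp: submatrix_def)
qed

lemma submatrix_mult_index:
  assumes A: "A \<in> carrier_mat n n" and B: "B \<in> carrier_mat n n"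
    and I: "I \<subseteq> {0..<n}" and J: "J \<subseteq> {0..<n}" and H: "H \<subseteq> {0..<n}"
    and i: "i < card I" and h: "h < card H"
  shows "(submatrix A I J * submatrix B J H) $$ (i, h) =
    (\<Sum>j\<in>J. A $$ (pick I i, j) * B $$ (j, pick H h))"
proof -
  note AIJ = submatrix_carrier[OF A I J] and BJH = submatrix_carrier[OF B J H]
  have "(submatrix A I J * submatrix B J H) $$ (i, h) =
    (\<Sum>j<card J. A $$ (pick I i, pick J j) * B $$ (pick J j, pick H h))"
    using AIJ BJH i h by (simp add: scalar_prod_def atLeast0LessThan)
  also have "\<dots> = (\<Sum>j\<in>J. A $$ (pick I i, j) * B $$ (j, pick H h))"
    using J by (intro sum.reindex_bij_betw bij_betw_pick finite_subset[OF J]) simp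
  finally show ?thesis .
qed

text \<open>Block multiplication: the inner summation index is split between \<open>S\<close> and
  its complement.\<close>

lemma submatrix_mult_split:
  assumes A: "A \<in> carrier_mat n n" and B: "B \<in> carrier_mat n n"
    and I: "I \<subseteq> {0..<n}" and H: "H \<subseteq> {0..<n}"
    and S: "S \<subseteq> {0..<n}" and T: "T = {0..<n} - S"
  shows "submatrix A I T * submatrix B T H + submatrix A I S * submatrix B S H =
    submatrix (A * B) I H"
proof -
  have T': "T \<subseteq> {0..<n}"
    using T by auto
  have AB: "A * B \<in> carrier_mat n n"
    using A B by simp
  note carr = submatrix_carrier(1)[OF A I] submatrix_carrier(1)[OF B _ H]
    submatrix_carrier(1)[OF AB I H]
  show ?thesis
  proof (rule eq_matI)
    fix i h assume "i < dim_row (submatrix (A * B) I H)" "h < dim_col (submatrix (A * B) I H)"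
    then have i: "i < card I" and h: "h < card H"
      using carr(3) by auto
    let ?f = "\<lambda>j. A $$ (pick I i, j) * B $$ (j, pick H h)"
    have "sum ?f T + sum ?f S = sum ?f {0..<n}"
      unfolding T using S by (simp add: sum.subset_diff[symmetric])
    also have "\<dots> = (A * B) $$ (pick I i, pick H h)"
      using A B pick_less_dim[OF I i] pick_less_dim[OF H h] by (simp add: scalar_prod_def)
    finally show "(submatrix A I T * submatrix B T H + submatrix A I S * submatrix B S H) $$ (i, h) =
      submatrix (A * B) I H $$ (i, h)"
      using carr(1)[OF S] carr(1)[OF T'] carr(2)[OF S] carr(2)[OF T'] i h
        submatrix_mult_index[OF A B I S H i h] submatrix_mult_index[OF A B I T' H i h]
        submatrix_carrier(2)[OF AB I H i h]
      by simp
  qed (use carr(1)[OF S] carr(2)[OF S] carr(3) in auto)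
qed

lemma submatrix_one:
  assumes I: "I \<subseteq> {0..<n}"
  shows "submatrix (1\<^sub>m n) I I = 1\<^sub>m (card I)"
proof (rule eq_matI)
  fix i j assume "i < dim_row (1\<^sub>m (card I))" "j < dim_col (1\<^sub>m (card I))"
  then have ij: "i < card I" "j < card I"
    by auto
  then have "pick I i = pick I j \<longleftrightarrow> i = j"
    by (metis card_pick_le)
  then show "submatrix (1\<^sub>m n) I I $$ (i, j) = 1\<^sub>m (card I) $$ (i, j)"
    using submatrix_carrier(2)[OF one_carrier_mat I I ij] pick_less_dim[OF I] ij by simp
qed (use submatrix_carrier(1)[OF one_carrier_mat I I] in auto)

lemma submatrix_one_disjoint:
  assumes I: "I \<subseteq> {0..<n}" and J: "J \<subseteq> {0..<n}" and "I \<inter> J = {}"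
  shows "submatrix (1\<^sub>m n) I J = 0\<^sub>m (card I) (card J)"
proof (rule eq_matI)
  fix i j assume "i < dim_row (0\<^sub>m (card I) (card J))" "j < dim_col (0\<^sub>m (card I) (card J))"
  then have ij: "i < card I" "j < card J"
    by auto
  then have "pick I i \<noteq> pick J j"
    using pick_in_set_le[of i I] pick_in_set_le[of j J] \<open>I \<inter> J = {}\<close> by auto
  then show "submatrix (1\<^sub>m n) I J $$ (i, j) = 0\<^sub>m (card I) (card J) $$ (i, j)"
    using submatrix_carrier(2)[OF one_carrier_mat I J ij] pick_less_dim[OF I] pick_less_dim[OF J] ij
    by simp
qed (use submatrix_carrier(1)[OF one_carrier_mat I J] in auto)

text \<open>The \<open>T\<close> columns of A B = 1 give two block equations; eliminating the block
  \<open>submatrix B S T\<close> from them by means of \<open>X\<close> leaves the Schur complement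
  times \<open>submatrix B T T\<close>.\<close>

lemma schur_complement_inverse:
  fixes A B :: "'a :: field mat"
  assumes A: "A \<in> carrier_mat n n" and B: "B \<in> carrier_mat n n" and AB: "A * B = 1\<^sub>m n"
    and S: "S \<subseteq> {0..<n}" and T: "T = {0..<n} - S"
    and X: "X \<in> carrier_mat (card S) (card S)" and XA: "X * submatrix A S S = 1\<^sub>m (card S)"
  shows "(submatrix A T T - submatrix A T S * X * submatrix A S T) * submatrix B T T =
    1\<^sub>m (card T)"
proof -
  have T': "T \<subseteq> {0..<n}" and disj: "S \<inter> T = {}"
    using T by auto
  define ATT ATS AST ASS BTT BST where defs:
    "ATT = submatrix A T T" "ATS = submatrix A T S" "AST = submatrix A S T" "ASS = submatrix A S S"
    "BTT = submatrix B T T" "BST = submatrix B S T"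
  note carr = submatrix_carrier(1)[OF A T' T', folded defs]
    submatrix_carrier(1)[OF A T' S, folded defs] submatrix_carrier(1)[OF A S T', folded defs]
    submatrix_carrier(1)[OF A S S, folded defs] submatrix_carrier(1)[OF B T' T', folded defs]
    submatrix_carrier(1)[OF B S T', folded defs] X
  have TT: "ATT * BTT + ATS * BST = 1\<^sub>m (card T)"
    using submatrix_mult_split[OF A B T' T' S T] by (simp add: AB submatrix_one[OF T'] defs)
  have ST: "AST * BTT + ASS * BST = 0\<^sub>m (card S) (card T)"
    using submatrix_mult_split[OF A B S T' S T]
    by (simp add: AB submatrix_one_disjoint[OF S T' disj] defs)
  have XST: "X * (AST * BTT) + BST = 0\<^sub>m (card S) (card T)"
  proof -
    have "X * (AST * BTT) + BST = X * (AST * BTT) + X * (ASS * BST)"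
      using carr XA by (simp add: assoc_mult_mat[symmetric, of X _ _ ASS _ BST] flip: defs)
    also have "\<dots> = X * (AST * BTT + ASS * BST)"
      using carr by (intro mult_add_distrib_mat[symmetric]) auto
    finally show ?thesis
      using ST carr by simp
  qed
  have "(ATT - ATS * X * AST) * BTT = ATT * BTT - ATS * (X * (AST * BTT))"
    using carr
    by (subst minus_mult_distrib_mat[of _ "card T" "card T"])
      (auto simp: assoc_mult_mat[of _ "card T" "card S" _ "card S"]
        assoc_mult_mat[of _ "card T" "card S" _ "card T"]
        assoc_mult_mat[of _ "card S" "card S" _ "card T"])
  \<comment> \<open>The product \<open>ATS * BST\<close> is added and subtracted, so that
    \<open>TT\<close> evaluates the first bracket and \<open>XST\<close> annihilates the
    second.\<close>
  also have "\<dots> = (ATT * BTT + ATS * BST) - (ATS * (X * (AST * BTT)) + ATS * BST)"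
    using carr by (intro eq_matI) auto
  also have "ATS * (X * (AST * BTT)) + ATS * BST = ATS * (X * (AST * BTT) + BST)"
    using carr by (intro mult_add_distrib_mat[symmetric]) auto
  also have "\<dots> = 0\<^sub>m (card T) (card T)"
    using XST carr by simp
  also have "(ATT * BTT + ATS * BST) - 0\<^sub>m (card T) (card T) = 1\<^sub>m (card T)"
    unfolding TT by (intro eq_matI) auto
  finally show ?thesis
    by (simp add: defs)
qed

text \<open>Multiplying the Penrose equation A Y A = A by \<open>X\<close> on both sides gives Y =
  X, which settles the uniqueness demanded by \<open>THE\<close>.\<close>

lemma pinv_eq_inverse:
  assumes A: "A \<in> carrier_mat n n" and X: "X \<in> carrier_mat n n"
    and AX: "A * X = 1\<^sub>m n" and XA: "X * A = 1\<^sub>m n"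
  shows "pinv A = X"
  unfolding pinv_def
proof (rule the_equality)
  show "is_pinv A X"
    using assms by (simp add: is_pinv_def)
  fix Y assume "is_pinv A Y"
  then have Y: "Y \<in> carrier_mat n n" and AYA: "A * Y * A = A"
    using A by (auto simp: is_pinv_def)
  have "Y = (X * A) * Y * (A * X)"
    using Y by (simp add: AX XA)
  also have "\<dots> = X * (A * Y * A) * X"
    using A X Y by (simp add: assoc_mult_mat[of _ n n _ n _ n])
  also have "\<dots> = X"
    using X by (simp add: AYA XA)
  finally show "Y = X" .
qed

text \<open>
  The Schur complement formula is applied twice: first with the roles of \<open>M\<close> and \<open>K\<close> exchanged, to
  see that \<open>K\<^sub>S\<close> is invertible.
\<close>

lemma predictive_cov_inverse:
  assumes M: "M \<in> carrier_mat n n" and K: "K \<in> carrier_mat n n"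
    and MK: "M * K = 1\<^sub>m n" and KM: "K * M = 1\<^sub>m n"
    and S: "S \<subseteq> {0..<n}" and T: "T = {0..<n} - S"
    and det: "det (submatrix M T T) \<noteq> 0"
  shows "predictive_cov K S \<in> carrier_mat (card T) (card T)"
    and "predictive_cov K S * submatrix M T T = 1\<^sub>m (card T)"
proof -
  have T': "T \<subseteq> {0..<n}" and ST: "S = {0..<n} - T"
    using S T by auto
  obtain Y where Y: "Y \<in> carrier_mat (card T) (card T)" "Y * submatrix M T T = 1\<^sub>m (card T)"
    using square_inverse_exists[OF submatrix_carrier(1)[OF M T' T'] det] by metis
  \<comment> \<open>This is the Schur complement of \<open>submatrix M T T\<close> in
    \<open>M\<close>, which turns out to be the inverse of \<open>submatrix K S S\<close>.\<close>
  define X where "X = submatrix M S S - submatrix M S T * Y * submatrix M T S"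
  have KSS: "submatrix K S S \<in> carrier_mat (card S) (card S)"
    by (rule submatrix_carrier(1)[OF K S S])
  have X: "X \<in> carrier_mat (card S) (card S)"
    unfolding X_def using submatrix_carrier(1)[OF M] S T' Y(1)
    by (intro minus_carrier_mat mult_carrier_mat) auto
  have XK: "X * submatrix K S S = 1\<^sub>m (card S)"
    unfolding X_def by (rule schur_complement_inverse[OF M K MK T' ST Y])
  have pinv: "pinv (submatrix K S S) = X"
    using mat_mult_left_right_inverse[OF X KSS XK] by (rule pinv_eq_inverse[OF KSS X _ XK])
  have cov: "predictive_cov K S =
      submatrix K T T - submatrix K T S * X * submatrix K S T"
    using K by (simp add: predictive_cov_def Let_def T pinv)
  show "predictive_cov K S * submatrix M T T = 1\<^sub>m (card T)"
    unfolding cov by (rule schur_complement_inverse[OF K M KM S T X XK])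
  show "predictive_cov K S \<in> carrier_mat (card T) (card T)"
    unfolding cov using submatrix_carrier(1)[OF K] S T' X
    by (intro minus_carrier_mat mult_carrier_mat) auto
qed

text \<open>Since \<open>pick I\<close> is injective, diagonal positions of the block are exactly
  those coming from the diagonal of the full matrix.\<close>

lemma submatrix_shift:
  fixes L :: "'a :: comm_ring_1 mat"
  assumes L: "L \<in> carrier_mat n n" and I: "I \<subseteq> {0..<n}"
  shows "submatrix (L + d \<cdot>\<^sub>m 1\<^sub>m n) I I = submatrix L I I + d \<cdot>\<^sub>m 1\<^sub>m (card I)"
proof -
  have M: "L + d \<cdot>\<^sub>m 1\<^sub>m n \<in> carrier_mat n n"
    using L by simp
  note LI = submatrix_carrier[OF L I I] and MI = submatrix_carrier[OF M I I]
  show ?thesis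
  proof (rule eq_matI)
    fix i j
    assume "i < dim_row (submatrix L I I + d \<cdot>\<^sub>m 1\<^sub>m (card I))"
      "j < dim_col (submatrix L I I + d \<cdot>\<^sub>m 1\<^sub>m (card I))"
    then have ij: "i < card I" "j < card I"
      by auto
    then have "pick I i = pick I j \<longleftrightarrow> i = j"
      by (metis card_pick_le)
    then show "submatrix (L + d \<cdot>\<^sub>m 1\<^sub>m n) I I $$ (i, j) =
        (submatrix L I I + d \<cdot>\<^sub>m 1\<^sub>m (card I)) $$ (i, j)"
      using MI(2)[OF ij] LI(1) LI(2)[OF ij] pick_less_dim[OF I] ij L by simp
  qed (use MI(1) in auto)
qed

text \<open>Passing to a principal block keeps the diagonal entry and only drops nonnegative terms
  from the off-diagonal row sum.\<close>

lemma diag_dominant_submatrix: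
  assumes A: "A \<in> carrier_mat n n" and dom: "diag_dominant A" and I: "I \<subseteq> {0..<n}"
  shows "diag_dominant (submatrix A I I)"
proof -
  note AI = submatrix_carrier[OF A I I]
  have "(\<Sum>j\<in>{..<card I} - {i}. \<bar>submatrix A I I $$ (i, j)\<bar>) \<le> submatrix A I I $$ (i, i)"
    if i: "i < card I" for i
  proof -
    have bij: "bij_betw (pick I) ({..<card I} - {i}) (I - {pick I i})"
      using bij_betw_pick[OF finite_subset[OF I]] i pick_in_set_le[OF i]
      by (intro bij_betw_DiffI) auto
    have "(\<Sum>j\<in>{..<card I} - {i}. \<bar>submatrix A I I $$ (i, j)\<bar>) =
      (\<Sum>j\<in>{..<card I} - {i}. \<bar>A $$ (pick I i, pick I j)\<bar>)"
      using AI(2) i by (intro sum.cong) auto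
    also have "\<dots> = (\<Sum>j\<in>I - {pick I i}. \<bar>A $$ (pick I i, j)\<bar>)"
      by (rule sum.reindex_bij_betw[OF bij])
    also have "\<dots> \<le> (\<Sum>j\<in>{..<n} - {pick I i}. \<bar>A $$ (pick I i, j)\<bar>)"
      using I by (intro sum_mono2) auto
    also have "\<dots> \<le> A $$ (pick I i, pick I i)"
      using dom A pick_less_dim[OF I i] by (auto simp: diag_dominant_def)
    finally show ?thesis
      using AI(2) i by simp
  qed
  then show ?thesis
    using AI(1) by (auto simp: diag_dominant_def)
qed

subsection \<open>The graph Laplacian\<close>

lemma laplacian_carrier [simp]: "laplacian N G w \<in> carrier_mat N N"
  by (auto simp: laplacian_def adjacency_mat_def intro!: minus_carrier_mat)

text \<open>The weight of a possible loop occurs in both the degree and the adjacency matrix and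
  cancels, so the diagonal sum skips \<open>i\<close>.\<close>

lemma laplacian_index:
  assumes "i < N" "j < N"
  shows "laplacian N G w $$ (i, j) =
    (if i = j then \<Sum>k\<in>{..<N} - {i}. adjacency_mat N G w $$ (i, k)
     else - adjacency_mat N G w $$ (i, j))"
proof -
  have "adjacency_mat N G w \<in> carrier_mat N N"
    by (simp add: adjacency_mat_def)
  then show ?thesis
    using assms by (auto simp: laplacian_def degree_mat_def mat_diag_def sum.remove[of "{..<N}" j])
qed

lemma laplacian_symmetric:
  assumes G: "weighted_graph N G w" and "i < N" "j < N"
  shows "laplacian N G w $$ (i, j) = laplacian N G w $$ (j, i)"
proof -
  interpret pair_sym_digraph G
    using G by (simp add: weighted_graph_def)
  have "(i, j) \<in> parcs G \<longleftrightarrow> (j, i) \<in> parcs G"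
    using arcs_symmetric by blast
  then have "adjacency_mat N G w $$ (i, j) = adjacency_mat N G w $$ (j, i)"
    using G \<open>i < N\<close> \<open>j < N\<close> by (auto simp: adjacency_mat_def weighted_graph_def)
  then show ?thesis
    using \<open>i < N\<close> \<open>j < N\<close> by (auto simp: laplacian_index)
qed

text \<open>Weights are nonnegative, so each diagonal entry equals the sum of the moduli of the
  other entries in its row.\<close>

lemma laplacian_diag_dominant:
  assumes G: "weighted_graph N G w"
  shows "diag_dominant (laplacian N G w)"
proof -
  have "adjacency_mat N G w $$ (i, j) \<ge> 0" if "i < N" "j < N" for i j
    using G that by (auto simp: adjacency_mat_def weighted_graph_def intro: less_imp_le)
  then show ?thesis
    by (auto simp: diag_dominant_def carrier_matD[OF laplacian_carrier] laplacian_index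
        intro!: sum_mono)
qed

section \<open>Largest predictive eigenvalue in terms of the cut-off frequency\<close>

lemma lambda_max_predictive_cov:
  assumes G: "weighted_graph N G w" and "\<delta> > 0"
    and L: "L = laplacian N G w" and K: "K = grf_cov L \<delta>"
    and S: "S \<subset> {0..<N}"
  shows "lambda_max (predictive_cov K S) = 1 / (cutoff_freq 1 L S + \<delta>)" (is ?formula)
    and "cutoff_freq 1 L S \<ge> 0" (is ?nonneg)
proof -
  define T where "T = {0..<N} - S"
  have S': "S \<subseteq> {0..<N}" and T: "T \<subseteq> {0..<N}" and "card T > 0"
    using S by (auto simp: T_def card_gt_0_iff)
  have Lc: "L \<in> carrier_mat N N" and dom: "diag_dominant L"
    using laplacian_diag_dominant[OF G] by (simp_all add: L)
  define M where "M = L + \<delta> \<cdot>\<^sub>m 1\<^sub>m N"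
  have M: "M \<in> carrier_mat N N"
    using Lc by (simp add: M_def)
  have "det M \<noteq> 0"
    unfolding M_def by (rule diag_dominant_shift_det[OF Lc dom \<open>\<delta> > 0\<close>])
  then obtain B where B: "B \<in> carrier_mat N N" "M * B = 1\<^sub>m N" "B * M = 1\<^sub>m N"
      "mat_inverse M = Some B"
    using square_inverse_exists[OF M] by metis
  have "K = B"
    using Lc B(4) by (simp add: K grf_cov_def M_def)
  define LT where "LT = submatrix L T T"
  have LT: "LT \<in> carrier_mat (card T) (card T)"
    unfolding LT_def by (rule submatrix_carrier(1)[OF Lc T T])
  have domT: "diag_dominant LT"
    unfolding LT_def by (rule diag_dominant_submatrix[OF Lc dom T])
  have MT: "submatrix M T T = LT + \<delta> \<cdot>\<^sub>m 1\<^sub>m (card T)"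
    unfolding M_def LT_def by (rule submatrix_shift[OF Lc T])
  have detT: "det (submatrix M T T) \<noteq> 0"
    unfolding MT by (rule diag_dominant_shift_det[OF LT domT \<open>\<delta> > 0\<close>])
  note P = predictive_cov_inverse[OF M B(1-3) S' T_def detT, folded \<open>K = B\<close>, unfolded MT]
  have nonempty: "spectrum LT \<noteq> {}"
  proof (rule symmetric_spectrum_nonempty[OF LT \<open>card T > 0\<close>])
    fix i j assume "i < card T" "j < card T"
    then show "LT $$ (i, j) = LT $$ (j, i)"
      unfolding LT_def using submatrix_carrier(2)[OF Lc T T] pick_less_dim[OF T]
      by (simp add: L laplacian_symmetric[OF G])
  qed
  have nonneg: "x \<ge> 0" if "x \<in> spectrum LT" for x
    using that diag_dominant_eigenvalue_nonneg[OF LT domT] by (simp add: spectrum_def)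
  \<comment> \<open>For k = 1 both the root and the matrix power are trivial.\<close>
  have cutoff: "cutoff_freq 1 L S = lambda_min LT"
    using Lc by (simp add: cutoff_freq_def Let_def LT_def T_def)
  show ?formula
    unfolding cutoff by (rule lambda_max_inverse_shift[OF LT P \<open>\<delta> > 0\<close> nonempty nonneg])
  show ?nonneg
    unfolding cutoff lambda_min_def
    using card_finite_spectrum(1)[OF LT] nonempty by (intro nonneg Min_in)
qed

theorem proposition1:
  fixes N m :: nat and G :: "nat pair_pre_digraph" and w :: "nat \<Rightarrow> nat \<Rightarrow> real"
    and \<delta> :: real and L K :: "real mat"
  assumes "weighted_graph N G w"
    and "Digraph_Component.connected (with_proj G)"
    and "L = laplacian N G w"
    and "\<delta> > 0"
    and "K = grf_cov L \<delta>"
    and "1 \<le> m" and "m \<le> N - 1"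
  shows "{S. is_arg_max (cutoff_freq 1 L) (\<lambda>S. S \<subseteq> {0..<N} \<and> card S = m) S}
       = {S. is_arg_min (\<lambda>S. lambda_max (predictive_cov K S)) (\<lambda>S. S \<subseteq> {0..<N} \<and> card S = m) S}"
proof -
  let ?P = "\<lambda>S. S \<subseteq> {0..<N} \<and> card S = m"
  \<comment> \<open>Subtraction is truncated, so \<open>1 \<le> m\<close> is what excludes N = 0;
    then m < N and the complement of \<open>S\<close> is nonempty.\<close>
  have "S \<subset> {0..<N}" if "?P S" for S
    using that \<open>1 \<le> m\<close> \<open>m \<le> N - 1\<close> by auto
  note formula = lambda_max_predictive_cov[OF assms(1,4,3,5) this]
  \<comment> \<open>Nonnegative cut-off values keep both denominators positive, so strict
    comparisons reverse. Both \<open>is_arg_max\<close> and \<open>is_arg_min\<close> are defined by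
    the absence of a strictly better candidate, so this is enough.\<close>
  have "lambda_max (predictive_cov K S) < lambda_max (predictive_cov K S') \<longleftrightarrow>
      cutoff_freq 1 L S > cutoff_freq 1 L S'" if "?P S" "?P S'" for S S'
    using formula(2)[OF that(1)] formula(2)[OF that(2)] \<open>\<delta> > 0\<close>
    by (simp add: formula(1)[OF that(1)] formula(1)[OF that(2)] divide_simps)
  then show ?thesis
    by (auto simp: is_arg_max_def is_arg_min_def)
qed

end
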